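(* Let $X$ be a Tychonoff space and let $E$ be a sublattice of $C(X)$. Then: (i) If $E$ is order dense in $C(X)$, then for every $f\in E_+$ and every nonempty open $U\subset X$ there are a nonempty open $V\subset U$ and $e\in E$ with $0\le e\le f$ such that $e$ vanishes outside of $U$ and coincides with $f$ on $V$. (ii) If $\mathbf{1}\in E$, then $E$ is order dense in $C(X)$ if and only if for every nonempty open $U\subset X$ there are a nonempty open $V\subset U$ and $e\in E$ such that $\mathbf{1}_{\overline{V}}\le e\le\mathbf{1}_U$ pointwise.
   Context: $C(X)$ is the vector lattice of all continuous real-valued functions on $X$ with pointwise operations. A sublattice is a linear subspace closed under the lattice operations. $E_+=\{f\in E:f\ge0\}$. $E$ is order dense in $C(X)$ if for every $f\in C(X)$ with $f\ge0$, $f\neq0$, there is $e\in E$ with $e\ne0$, $0\le e\le f$. $\mathbf{1}_A$ is the indicator function of $A\subset X$ and $\mathbf{1}=\mathbf{1}_X$. *)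

theory Defs
  imports "HOL-Analysis.Analysis"
begin

definition tychonoff_space :: "'a topology \<Rightarrow> bool" where
  "tychonoff_space X \<longleftrightarrow> completely_regular_space X \<and> Hausdorff_space X"

text \<open>Real-valued functions on \<open>topspace X\<close> are represented by extensional functions on the
  ambient type, so that equality of representatives is equality of functions on \<open>topspace X\<close>.
  All pointwise operations are restricted accordingly.\<close>

definition cont_funs :: "'a topology \<Rightarrow> ('a \<Rightarrow> real) set" where
  "cont_funs X = {f \<in> extensional (topspace X). continuous_map X euclideanreal f}"

definition const_fun :: "'a topology \<Rightarrow> real \<Rightarrow> 'a \<Rightarrow> real" where
  "const_fun X c = (\<lambda>x\<in>topspace X. c)"

definition fun_le :: "'a topology \<Rightarrow> ('a \<Rightarrow> real) \<Rightarrow> ('a \<Rightarrow> real) \<Rightarrow> bool" where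
  "fun_le X f g \<longleftrightarrow> (\<forall>x\<in>topspace X. f x \<le> g x)"

definition linear_subspace :: "'a topology \<Rightarrow> ('a \<Rightarrow> real) set \<Rightarrow> bool" where
  "linear_subspace X E \<longleftrightarrow>
     E \<subseteq> cont_funs X \<and>
     const_fun X 0 \<in> E \<and>
     (\<forall>f\<in>E. \<forall>g\<in>E. (\<lambda>x\<in>topspace X. f x + g x) \<in> E) \<and>
     (\<forall>c. \<forall>f\<in>E. (\<lambda>x\<in>topspace X. c * f x) \<in> E)"

definition sublattice :: "'a topology \<Rightarrow> ('a \<Rightarrow> real) set \<Rightarrow> bool" where
  "sublattice X E \<longleftrightarrow>
     linear_subspace X E \<and>
     (\<forall>f\<in>E. \<forall>g\<in>E. (\<lambda>x\<in>topspace X. max (f x) (g x)) \<in> E) \<and>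
     (\<forall>f\<in>E. \<forall>g\<in>E. (\<lambda>x\<in>topspace X. min (f x) (g x)) \<in> E)"

definition pos_cone :: "'a topology \<Rightarrow> ('a \<Rightarrow> real) set \<Rightarrow> ('a \<Rightarrow> real) set" where
  "pos_cone X E = {f \<in> E. fun_le X (const_fun X 0) f}"

definition order_dense :: "'a topology \<Rightarrow> ('a \<Rightarrow> real) set \<Rightarrow> bool" where
  "order_dense X E \<longleftrightarrow>
     (\<forall>f \<in> cont_funs X. fun_le X (const_fun X 0) f \<and> f \<noteq> const_fun X 0 \<longrightarrow>
        (\<exists>e\<in>E. e \<noteq> const_fun X 0 \<and> fun_le X (const_fun X 0) e \<and> fun_le X e f))"

end

theory Submission
  imports Defs
begin

text \<open>
  Complete regularity supplies, for every nonempty open \<open>U\<close>, a nonzero nonnegative continuous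
  function that vanishes off \<open>U\<close>; order density of \<open>E\<close> then puts a nonzero \<open>h \<ge> 0\<close> with the same
  property into \<open>E\<close> itself (\<open>order_dense_bump\<close>). Although \<open>h\<close> has no prescribed values on \<open>U\<close>, its
  multiples \<open>n h\<close> become large wherever \<open>h > 0\<close>, so the truncation \<open>min f (n h)\<close> stays in \<open>E\<close>,
  still vanishes off \<open>U\<close>, and equals \<open>f\<close> on the open set where \<open>n h > f\<close>
  (\<open>order_dense_local_copy\<close>). This is the first part.

  In the second part, the local copies of the constant \<open>1\<close> are the functions sought: being equal to
  \<open>1\<close> on \<open>V\<close> they equal \<open>1\<close> on its closure. Conversely, a nonzero \<open>f \<ge> 0\<close> exceeds some constant
  \<open>c > 0\<close> on a nonempty open set \<open>U\<close>, and if \<open>e\<close> lies between the indicators of \<open>closure V\<close> and \<open>U\<close>,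
  then \<open>c e\<close> is a nonzero element of \<open>E\<close> below \<open>f\<close>.
\<close>

lemma sublattice_continuous:
  assumes "sublattice X E" "e \<in> E"
  shows "continuous_map X euclideanreal e"
  using assms unfolding sublattice_def linear_subspace_def cont_funs_def by blast

lemma sublattice_scale:
  assumes "sublattice X E" "e \<in> E"
  shows "(\<lambda>x\<in>topspace X. c * e x) \<in> E"
  using assms unfolding sublattice_def linear_subspace_def by blast

lemma sublattice_min:
  assumes "sublattice X E" "f \<in> E" "g \<in> E"
  shows "(\<lambda>x\<in>topspace X. min (f x) (g x)) \<in> E"
  using assms unfolding sublattice_def by blast

lemma cont_funs_nonzero_witness:
  assumes "f \<in> cont_funs X" "f \<noteq> const_fun X 0"
  obtains x where "x \<in> topspace X" "f x \<noteq> 0"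
proof -
  have "\<not> (\<forall>x\<in>topspace X. f x = const_fun X 0 x)"
  proof
    assume "\<forall>x\<in>topspace X. f x = const_fun X 0 x"
    moreover have "f \<in> extensional (topspace X)" "const_fun X 0 \<in> extensional (topspace X)"
      using assms(1) by (auto simp: cont_funs_def const_fun_def)
    ultimately show False
      using assms(2) extensionalityI by metis
  qed
  then show ?thesis
    using that by (auto simp: const_fun_def)
qed

lemma openin_continuous_map_less:
  fixes f g :: "'a \<Rightarrow> real"
  assumes "continuous_map X euclideanreal f" "continuous_map X euclideanreal g"
  shows "openin X {x \<in> topspace X. f x < g x}"
proof -
  have "continuous_map X euclideanreal (\<lambda>x. g x - f x)"
    using assms by (intro continuous_intros)
  then have "openin X {x \<in> topspace X. g x - f x \<in> {0<..}}"
    by (rule openin_continuous_map_preimage) simp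
  then show ?thesis by simp
qed

lemma completely_regular_bump:
  assumes "completely_regular_space X" "openin X U" "x \<in> U"
  obtains g where "g \<in> cont_funs X" "fun_le X (const_fun X 0) g" "g x = 1"
    "\<And>y. y \<in> topspace X - U \<Longrightarrow> g y = 0"
proof -
  have x: "x \<in> topspace X - (topspace X - U)" and cl: "closedin X (topspace X - U)"
    using assms(2,3) openin_subset by blast+
  then obtain k where k: "continuous_map X (top_of_set {0..1::real}) k" "k x = 0"
      "k ` (topspace X - U) \<subseteq> {1}"
    using assms(1) unfolding completely_regular_space_def by metis
  have kb: "k y \<le> 1" if "y \<in> topspace X" for y
    using k(1) that by (auto simp: continuous_map_in_subtopology)
  \<comment> \<open>The separating function is \<open>0\<close> at the point and \<open>1\<close> off \<open>U\<close>, so it has to be flipped.\<close>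
  define g where "g = (\<lambda>y\<in>topspace X. 1 - k y)"
  have "continuous_map X euclideanreal (\<lambda>y. 1 - k y)"
    using k(1) by (intro continuous_intros) (auto simp: continuous_map_in_subtopology)
  then have "continuous_map X euclideanreal g"
    by (rule continuous_map_eq) (simp add: g_def)
  then have "g \<in> cont_funs X"
    by (simp add: cont_funs_def g_def)
  moreover have "fun_le X (const_fun X 0) g"
    using kb by (simp add: fun_le_def const_fun_def g_def)
  moreover have "g x = 1" using x k(2) by (simp add: g_def)
  moreover have "g y = 0" if "y \<in> topspace X - U" for y
    using that k(3) by (auto simp: g_def)
  ultimately show ?thesis using that by blast
qed

text \<open>
  Any element of \<open>E\<close> squeezed between \<open>0\<close> and a continuous bump function inherits its zeros, and
  being nonzero it must be positive somewhere in \<open>U\<close>.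
\<close>

lemma order_dense_bump:
  assumes "completely_regular_space X" "E \<subseteq> cont_funs X" "order_dense X E"
    and "openin X U" "U \<noteq> {}"
  obtains h x where "h \<in> E" "\<And>y. y \<in> topspace X \<Longrightarrow> 0 \<le> h y"
    "\<And>y. y \<in> topspace X - U \<Longrightarrow> h y = 0" "x \<in> U" "0 < h x"
proof -
  obtain a where a: "a \<in> U" using assms(5) by blast
  then have a': "a \<in> topspace X" using assms(4) openin_subset by blast
  obtain g where g: "g \<in> cont_funs X" "fun_le X (const_fun X 0) g" "g a = 1"
      "\<And>y. y \<in> topspace X - U \<Longrightarrow> g y = 0"
    using completely_regular_bump[OF assms(1,4) a] by blast
  have "g \<noteq> const_fun X 0" using g(3) a' by (auto simp: const_fun_def)
  then obtain h where h: "h \<in> E" "h \<noteq> const_fun X 0" "fun_le X (const_fun X 0) h" "fun_le X h g"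
    using assms(3) g(1,2) unfolding order_dense_def by blast
  have pos: "0 \<le> h y" if "y \<in> topspace X" for y
    using h(3) that by (auto simp: fun_le_def const_fun_def)
  have zero: "h y = 0" if "y \<in> topspace X - U" for y
    using h(4) that pos[of y] g(4)[OF that] by (force simp: fun_le_def)
  obtain x where x: "x \<in> topspace X" "h x \<noteq> 0"
    using cont_funs_nonzero_witness h(1,2) assms(2) by blast
  have "x \<in> U" using x zero by blast
  moreover have "0 < h x" using pos[OF x(1)] x(2) by simp
  ultimately show ?thesis using that[OF h(1) pos zero] by blast
qed

text \<open>
  A large multiple of a bump function in \<open>E\<close> exceeds \<open>f\<close> near one point of \<open>U\<close>, so cutting that
  multiple off at \<open>f\<close> reproduces \<open>f\<close> there.
\<close>

lemma order_dense_local_copy: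
  assumes "completely_regular_space X" "sublattice X E" "order_dense X E"
    and "f \<in> pos_cone X E" "openin X U" "U \<noteq> {}"
  shows "\<exists>V. \<exists>e\<in>E. openin X V \<and> V \<noteq> {} \<and> V \<subseteq> U \<and>
           fun_le X (const_fun X 0) e \<and> fun_le X e f \<and>
           (\<forall>x \<in> topspace X - U. e x = 0) \<and> (\<forall>x\<in>V. e x = f x)"
proof -
  have f: "f \<in> E" "\<And>y. y \<in> topspace X \<Longrightarrow> 0 \<le> f y"
    using assms(4) by (auto simp: pos_cone_def fun_le_def const_fun_def)
  have "E \<subseteq> cont_funs X"
    using assms(2) by (simp add: sublattice_def linear_subspace_def)
  then obtain h x where h: "h \<in> E" "\<And>y. y \<in> topspace X \<Longrightarrow> 0 \<le> h y"
      "\<And>y. y \<in> topspace X - U \<Longrightarrow> h y = 0" and x: "x \<in> U" "0 < h x"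
    using order_dense_bump[OF assms(1) _ assms(3,5,6)] by metis
  have sub: "U \<subseteq> topspace X" using assms(5) by (rule openin_subset)
  obtain n :: nat where n: "f x < real n * h x"
    using x(2) reals_Archimedean3 by blast
  define e where "e = (\<lambda>y\<in>topspace X. min (f y) ((\<lambda>z\<in>topspace X. real n * h z) y))"
  define V where "V = U \<inter> {y \<in> topspace X. f y < real n * h y}"
  have e_eq: "e y = min (f y) (real n * h y)" if "y \<in> topspace X" for y
    using that by (simp add: e_def)
  have "e \<in> E"
    unfolding e_def using assms(2) f(1) h(1) by (intro sublattice_min sublattice_scale)
  moreover have "openin X V"
    unfolding V_def
    using assms(2,5) f(1) h(1)
    by (intro openin_Int openin_continuous_map_less continuous_intros sublattice_continuous)
  moreover have "V \<noteq> {}" using x n sub by (auto simp: V_def)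
  moreover have "V \<subseteq> U" by (auto simp: V_def)
  moreover have "fun_le X (const_fun X 0) e" "fun_le X e f"
    using f(2) h(2) by (auto simp: fun_le_def const_fun_def e_eq)
  moreover have "e y = 0" if "y \<in> topspace X - U" for y
    using that f(2) h(3) by (simp add: e_eq)
  moreover have "e y = f y" if "y \<in> V" for y
    using that by (auto simp: V_def e_eq)
  ultimately show ?thesis by blast
qed

text \<open>
  The closure of \<open>V\<close> appears because \<open>{x. e x = 1}\<close> is closed and contains \<open>V\<close>.
\<close>

lemma order_dense_imp_indicator_sandwich:
  assumes "completely_regular_space X" "sublattice X E" "const_fun X 1 \<in> E" "order_dense X E"
    and "openin X U" "U \<noteq> {}"
  shows "\<exists>V. \<exists>e\<in>E. openin X V \<and> V \<noteq> {} \<and> V \<subseteq> U \<and>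
           fun_le X (indicator (X closure_of V)) e \<and> fun_le X e (indicator U)"
proof -
  have one: "const_fun X 1 \<in> pos_cone X E"
    using assms(3) by (simp add: pos_cone_def fun_le_def const_fun_def)
  obtain V e where e: "e \<in> E" "openin X V" "V \<noteq> {}" "V \<subseteq> U"
      "fun_le X (const_fun X 0) e" "fun_le X e (const_fun X 1)"
      "\<forall>x \<in> topspace X - U. e x = 0" "\<forall>x\<in>V. e x = const_fun X 1 x"
    using order_dense_local_copy[OF assms(1,2,4) one assms(5,6)]
    by (elim exE bexE conjE) (rule that)
  have "closedin X {x \<in> topspace X. e x = 1}"
    using sublattice_continuous[OF assms(2) e(1)]
      closedin_continuous_map_preimage[of X euclideanreal e "{1}"] by simp
  moreover have "V \<subseteq> {x \<in> topspace X. e x = 1}"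
    using e(8) openin_subset[OF e(2)] by (auto simp: const_fun_def)
  ultimately have "X closure_of V \<subseteq> {x \<in> topspace X. e x = 1}"
    by (simp add: closure_of_minimal)
  then have "fun_le X (indicator (X closure_of V)) e"
    using e(5) by (auto simp: fun_le_def const_fun_def indicator_def)
  moreover have "fun_le X e (indicator U)"
    using e(6,7) by (auto simp: fun_le_def const_fun_def indicator_def)
  ultimately show ?thesis using e(1-4) by blast
qed

text \<open>
  Scaling turns the bound \<open>e \<le> indicator U\<close> into \<open>c e \<le> c indicator U \<le> f\<close> when \<open>f > c\<close> on \<open>U\<close>,
  while \<open>e \<ge> 1\<close> on the nonempty \<open>V\<close> keeps \<open>c e\<close> from being zero.
\<close>

lemma indicator_sandwich_imp_order_dense:
  assumes "sublattice X E"
    and sandwich: "\<And>U. openin X U \<Longrightarrow> U \<noteq> {} \<Longrightarrow>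
      \<exists>V. \<exists>e\<in>E. openin X V \<and> V \<noteq> {} \<and> V \<subseteq> U \<and>
        fun_le X (indicator (X closure_of V)) e \<and> fun_le X e (indicator U)"
  shows "order_dense X E"
  unfolding order_dense_def
proof (intro ballI impI, elim conjE)
  fix f assume f: "f \<in> cont_funs X" "fun_le X (const_fun X 0) f" "f \<noteq> const_fun X 0"
  have pos: "0 \<le> f y" if "y \<in> topspace X" for y
    using f(2) that by (auto simp: fun_le_def const_fun_def)
  obtain a where a: "a \<in> topspace X" "f a \<noteq> 0"
    using cont_funs_nonzero_witness f(1,3) by blast
  \<comment> \<open>Strictly below \<open>f a\<close>, so that \<open>a\<close> lies in the open set \<open>{y. c < f y}\<close>.\<close>
  define c where "c = f a / 2"
  have c: "0 < c" "c < f a" using pos[OF a(1)] a(2) by (auto simp: c_def)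
  define U where "U = {y \<in> topspace X. c < f y}"
  have "openin X U"
    unfolding U_def using f(1)
    by (intro openin_continuous_map_less continuous_intros) (auto simp: cont_funs_def)
  moreover have "U \<noteq> {}" using a c by (auto simp: U_def)
  ultimately obtain V e where e: "e \<in> E" "openin X V" "V \<noteq> {}"
      "fun_le X (indicator (X closure_of V)) e" "fun_le X e (indicator U)"
    using sandwich by meson
  define d where "d = (\<lambda>y\<in>topspace X. c * e y)"
  have e0: "0 \<le> e y" if "y \<in> topspace X" for y
    using e(4) that by (metis fun_le_def indicator_pos_le order_trans)
  obtain b where b: "b \<in> V" using e(3) by blast
  then have b': "b \<in> topspace X" "b \<in> X closure_of V"
    using openin_subset[OF e(2)] closure_of_subset by blast+
  then have "1 \<le> e b" using e(4) by (force simp: fun_le_def)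
  then have "d b \<noteq> const_fun X 0 b" using b'(1) c by (simp add: d_def const_fun_def)
  then have "d \<noteq> const_fun X 0" by auto
  moreover have "d \<in> E" unfolding d_def using assms(1) e(1) by (rule sublattice_scale)
  moreover have "fun_le X (const_fun X 0) d"
    using e0 c by (simp add: fun_le_def const_fun_def d_def)
  moreover have "fun_le X d f"
    unfolding fun_le_def
  proof
    fix y assume y: "y \<in> topspace X"
    have "c * e y \<le> c * indicator U y"
      using e(5) y c by (simp add: fun_le_def)
    also have "\<dots> \<le> f y" using pos[OF y] by (auto simp: indicator_def U_def)
    finally show "d y \<le> f y" using y by (simp add: d_def)
  qed
  ultimately show "\<exists>e\<in>E. e \<noteq> const_fun X 0 \<and> fun_le X (const_fun X 0) e \<and> fun_le X e f"
    by blast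
qed

theorem proposition2p3:
  fixes X :: "'a topology" and E :: "('a \<Rightarrow> real) set"
  assumes "tychonoff_space X" and "sublattice X E"
  shows
    "(order_dense X E \<longrightarrow>
       (\<forall>f \<in> pos_cone X E. \<forall>U. openin X U \<and> U \<noteq> {} \<longrightarrow>
          (\<exists>V. \<exists>e\<in>E. openin X V \<and> V \<noteq> {} \<and> V \<subseteq> U \<and>
             fun_le X (const_fun X 0) e \<and> fun_le X e f \<and>
             (\<forall>x \<in> topspace X - U. e x = 0) \<and> (\<forall>x\<in>V. e x = f x)))) \<and>
     (const_fun X 1 \<in> E \<longrightarrow>
       (order_dense X E \<longleftrightarrow>
          (\<forall>U. openin X U \<and> U \<noteq> {} \<longrightarrow>
             (\<exists>V. \<exists>e\<in>E. openin X V \<and> V \<noteq> {} \<and> V \<subseteq> U \<and>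
                fun_le X (indicator (X closure_of V)) e \<and> fun_le X e (indicator U)))))"
proof -
  have cr: "completely_regular_space X" using assms(1) by (simp add: tychonoff_space_def)
  note copy = order_dense_local_copy[OF cr assms(2)]
    and sandwich = order_dense_imp_indicator_sandwich[OF cr assms(2)]
    and dense = indicator_sandwich_imp_order_dense[OF assms(2)]
  show ?thesis
  proof (intro conjI impI iffI ballI allI, goal_cases)
    case (1 f U)
    then show ?case using copy by blast
  next
    case (2 U)
    then show ?case using sandwich by blast
  next
    case 3
    then show ?case by (intro dense) blast
  qed
qed

end
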